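(* Let $s>1$ and let $\mathcal{H}_s$ be the family of $s$-node graphlets with designated incidence orbits, and let $\mathbf{U}_s$ be the matrix indexed by $\mathcal{H}_s\times\mathcal{H}_s$ with $\mathbf{U}_s(i,j)=g(H_i\mid H_j)(v)$, where $v$ is any vertex in the designated orbit of $H_j$. Then: (a) for any source graph $G=(V,E)$ and any vertex $v\in V$, $$\mathbf{U}_s\, f(\mathcal{H}_s\mid G)(v) = g(\mathcal{H}_s\mid G)(v);$$ (b) the matrix $\mathbf{U}_s\Lambda_s$ is involutory, i.e. $$\mathbf{U}_s^{-1}=\Lambda_s\,\mathbf{U}_s\,\Lambda_s,$$ where $\Lambda_s=\mathrm{diag}(\lambda_i)$ with $\lambda_i=(-1)^{m(H_i)}$ for $H_i\in\mathcal{H}_s$, and $m(H_i)$ denotes the number of edges of $H_i$.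
   Context: All graphs are finite, undirected, simple (no multi-edges, no self-loops). A source graph $G=(V,E)$ has labeled vertices. For a connected graph $H$, the automorphism group of $H$ partitions $V(H)$ into orbits. A graphlet $H_\sigma$ is a connected graph $H$ (up to isomorphism) together with one designated orbit $\sigma$ of $V(H)$; $\mathcal{H}_s$ is the (finite) set of all graphlets $H_\sigma$ with $|V(H)|=s$, taken up to isomorphism (two graphlets are identified if there is an isomorphism of the graphs mapping the designated orbit to the designated orbit). For a graph $G$, a vertex $v\in V(G)$ and a graphlet $H_\sigma$: the gross count $g(H_\sigma\mid G)(v)$ is the number of subgraphs $H'$ of $G$ (distinct subgraphs, i.e. distinct pairs (vertex set, edge set)) such that $H'\cong H$ via an isomorphism mapping $\sigma$ to the orbit of $H'$ containing $v$ (equivalently, $v$ lies in the orbit of $H'$ corresponding to $\sigma$). The net count $f(H_\sigma\mid G)(v)$ is the number of such subgraphs $H'$ that are moreover induced subgraphs of $G$ (i.e. $E(H')=E(G)\cap (V(H')\times V(H'))$). The vectors $f(\mathcal{H}_s\mid G)(v)$ and $g(\mathcal{H}_s\mid G)(v)$ are indexed by $\mathcal{H}_s$ (in the same order as the rows/columns of $\mathbf{U}_s$) with entries $f(H_i\mid G)(v)$ and $g(H_i\mid G)(v)$ respectively. In $g(H_i\mid H_j)(v)$, $H_j$ is regarded as a source graph. *)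

theory Defs
  imports "Jordan_Normal_Form.Matrix"
begin

datatype 'a graph = Graph (verts: "'a set") (edges: "'a set set")

definition simple_graph :: "'a graph \<Rightarrow> bool" where
  "simple_graph G \<longleftrightarrow>
     finite (verts G) \<and> (\<forall>e\<in>edges G. e \<subseteq> verts G \<and> card e = 2)"

definition connected_graph :: "'a graph \<Rightarrow> bool" where
  "connected_graph G \<longleftrightarrow>
     verts G \<noteq> {} \<and>
     (\<forall>u\<in>verts G. \<forall>w\<in>verts G. (u, w) \<in> {(x, y). {x, y} \<in> edges G}\<^sup>*)"

definition subgraph_of :: "'a graph \<Rightarrow> 'a graph \<Rightarrow> bool" where
  "subgraph_of H G \<longleftrightarrow>
     simple_graph H \<and> verts H \<subseteq> verts G \<and> edges H \<subseteq> edges G"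

definition induced_subgraph_of :: "'a graph \<Rightarrow> 'a graph \<Rightarrow> bool" where
  "induced_subgraph_of H G \<longleftrightarrow>
     subgraph_of H G \<and> edges H = {e \<in> edges G. e \<subseteq> verts H}"

(* The values of the map outside verts H are irrelevant, so statements about it
   must only use its images of vertices of H. *)
definition graph_iso :: "('a \<Rightarrow> 'b) \<Rightarrow> 'a graph \<Rightarrow> 'b graph \<Rightarrow> bool" where
  "graph_iso \<phi> H K \<longleftrightarrow>
     bij_betw \<phi> (verts H) (verts K) \<and>
     (\<forall>u\<in>verts H. \<forall>w\<in>verts H. {u, w} \<in> edges H \<longleftrightarrow> {\<phi> u, \<phi> w} \<in> edges K)"

(* Only meaningful for x in verts H. *)
definition aut_orbit :: "'a graph \<Rightarrow> 'a \<Rightarrow> 'a set" where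
  "aut_orbit H x = {\<phi> x | \<phi>. graph_iso \<phi> H H}"

type_synonym 'a graphlet = "'a graph \<times> 'a set"

definition is_graphlet :: "nat \<Rightarrow> 'a graphlet \<Rightarrow> bool" where
  "is_graphlet s X \<longleftrightarrow>
     simple_graph (fst X) \<and> connected_graph (fst X) \<and> card (verts (fst X)) = s \<and>
     snd X \<in> aut_orbit (fst X) ` verts (fst X)"

definition graphlet_iso :: "'a graphlet \<Rightarrow> 'b graphlet \<Rightarrow> bool" where
  "graphlet_iso X Y \<longleftrightarrow> (\<exists>\<phi>. graph_iso \<phi> (fst X) (fst Y) \<and> \<phi> ` snd X = snd Y)"

(* Xs lists one representative of every isomorphism class of s-node graphlets,
   without repetition; both the order and the representatives are arbitrary.
   The vertices of the representatives are taken to be natural numbers, which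
   covers every finite graph up to isomorphism. *)
definition graphlet_family :: "nat \<Rightarrow> nat graphlet list \<Rightarrow> bool" where
  "graphlet_family s Xs \<longleftrightarrow>
     (\<forall>X\<in>set Xs. is_graphlet s X) \<and>
     (\<forall>X :: nat graphlet. is_graphlet s X \<longrightarrow>
        (\<exists>!i. i < length Xs \<and> graphlet_iso X (Xs ! i)))"

definition gross_count :: "'b graphlet \<Rightarrow> 'a graph \<Rightarrow> 'a \<Rightarrow> nat" where
  "gross_count X G v =
     card {H. subgraph_of H G \<and> v \<in> verts H \<and> graphlet_iso X (H, aut_orbit H v)}"

definition net_count :: "'b graphlet \<Rightarrow> 'a graph \<Rightarrow> 'a \<Rightarrow> nat" where
  "net_count X G v =
     card {H. induced_subgraph_of H G \<and> v \<in> verts H \<and> graphlet_iso X (H, aut_orbit H v)}"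

definition gross_vec :: "'b graphlet list \<Rightarrow> 'a graph \<Rightarrow> 'a \<Rightarrow> real vec" where
  "gross_vec Xs G v = vec (length Xs) (\<lambda>i. real (gross_count (Xs ! i) G v))"

definition net_vec :: "'b graphlet list \<Rightarrow> 'a graph \<Rightarrow> 'a \<Rightarrow> real vec" where
  "net_vec Xs G v = vec (length Xs) (\<lambda>i. real (net_count (Xs ! i) G v))"

(* r j is the vertex chosen in the designated orbit of the j-th graphlet. *)
definition U_mat :: "'b graphlet list \<Rightarrow> (nat \<Rightarrow> 'b) \<Rightarrow> real mat" where
  "U_mat Xs r =
     mat (length Xs) (length Xs)
       (\<lambda>(i, j). real (gross_count (Xs ! i) (fst (Xs ! j)) (r j)))"

definition Lambda_mat :: "'b graphlet list \<Rightarrow> real mat" where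
  "Lambda_mat Xs = mat_diag (length Xs) (\<lambda>i. (-1) ^ card (edges (fst (Xs ! i))))"


lemma graph_iso_comp:
  assumes "graph_iso f H K" "graph_iso g K L"
  shows "graph_iso (g \<circ> f) H L"
proof -
  have b: "bij_betw (g \<circ> f) (verts H) (verts L)"
    using assms bij_betw_trans unfolding graph_iso_def by blast
  have m: "f u \<in> verts K" if "u \<in> verts H" for u
    using assms(1) that unfolding graph_iso_def by (meson bij_betwE)
  show ?thesis
    using assms b m unfolding graph_iso_def by simp
qed

lemma graph_iso_inv:
  assumes "graph_iso f H K"
  shows "graph_iso (inv_into (verts H) f) K H"
proof -
  let ?g = "inv_into (verts H) f"
  have b: "bij_betw f (verts H) (verts K)"
    using assms unfolding graph_iso_def by blast
  have m: "?g u \<in> verts H" "f (?g u) = u" if "u \<in> verts K" for u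
    using b that by (metis bij_betw_def inv_into_into, metis b bij_betw_inv_into_right that)
  have "{u, w} \<in> edges K \<longleftrightarrow> {?g u, ?g w} \<in> edges H" if "u \<in> verts K" "w \<in> verts K" for u w
    using assms m[OF that(1)] m[OF that(2)] unfolding graph_iso_def by metis
  then show ?thesis
    using bij_betw_inv_into[OF b] unfolding graph_iso_def by blast
qed

lemma aut_orbit_subset:
  assumes "x \<in> verts H"
  shows "aut_orbit H x \<subseteq> verts H"
  using assms unfolding aut_orbit_def graph_iso_def by (auto dest: bij_betwE)

lemma graph_iso_image_aut_orbit:
  assumes f: "graph_iso f H K" and x: "x \<in> verts H"
  shows "f ` aut_orbit H x = aut_orbit K (f x)"
proof -
  let ?g = "inv_into (verts H) f"
  have b: "bij_betw f (verts H) (verts K)"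
    using f unfolding graph_iso_def by blast
  have gf: "?g (f y) = y" if "y \<in> verts H" for y
    using b that by (meson bij_betw_inv_into_left)
  have fg: "f (?g y) = y" if "y \<in> verts K" for y
    using b that by (meson bij_betw_inv_into_right)
  have fx: "f x \<in> verts K" using b x by (meson bij_betwE)
  show ?thesis
  proof (intro equalityI subsetI)
    fix y assume "y \<in> f ` aut_orbit H x"
    then obtain a where a: "graph_iso a H H" "y = f (a x)"
      unfolding aut_orbit_def by auto
    have "graph_iso (f \<circ> (a \<circ> ?g)) K K"
      by (rule graph_iso_comp[OF graph_iso_comp[OF graph_iso_inv[OF f] a(1)] f])
    moreover have "y = (f \<circ> (a \<circ> ?g)) (f x)" using a(2) gf[OF x] by simp
    ultimately show "y \<in> aut_orbit K (f x)" unfolding aut_orbit_def by blast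
  next
    fix y assume y: "y \<in> aut_orbit K (f x)"
    then obtain a where a: "graph_iso a K K" "y = a (f x)"
      unfolding aut_orbit_def by auto
    have "graph_iso (?g \<circ> (a \<circ> f)) H H"
      by (rule graph_iso_comp[OF graph_iso_comp[OF f a(1)] graph_iso_inv[OF f]])
    moreover have "?g y = (?g \<circ> (a \<circ> f)) x" using a(2) by simp
    ultimately have "?g y \<in> aut_orbit H x" unfolding aut_orbit_def by blast
    moreover have "f (?g y) = y" using fg y aut_orbit_subset[OF fx] by blast
    ultimately show "y \<in> f ` aut_orbit H x" by (metis imageI)
  qed
qed

lemma is_graphlet_orbit_subset:
  "is_graphlet s X \<Longrightarrow> snd X \<subseteq> verts (fst X)"
  unfolding is_graphlet_def by (metis aut_orbit_subset imageE)

lemma graphlet_iso_refl: "graphlet_iso X X"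
  unfolding graphlet_iso_def graph_iso_def by (rule exI[of _ id]) auto

lemma graphlet_iso_trans:
  assumes "graphlet_iso X Y" "graphlet_iso Y Z"
  shows "graphlet_iso X Z"
proof -
  obtain f g where f: "graph_iso f (fst X) (fst Y)" "f ` snd X = snd Y"
    and g: "graph_iso g (fst Y) (fst Z)" "g ` snd Y = snd Z"
    using assms unfolding graphlet_iso_def by blast
  have "(g \<circ> f) ` snd X = snd Z" unfolding image_comp[symmetric] f(2) by (rule g(2))
  then show ?thesis
    using graph_iso_comp[OF f(1) g(1)] unfolding graphlet_iso_def by blast
qed

lemma graphlet_iso_sym:
  assumes "is_graphlet s X" "graphlet_iso X Y"
  shows "graphlet_iso Y X"
proof -
  obtain f where f: "graph_iso f (fst X) (fst Y)" "f ` snd X = snd Y"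
    using assms(2) unfolding graphlet_iso_def by blast
  have i: "inj_on f (verts (fst X))"
    using f(1) unfolding graph_iso_def by (meson bij_betw_imp_inj_on)
  have "inv_into (verts (fst X)) f ` snd Y = snd X"
    using inv_into_image_cancel[OF i is_graphlet_orbit_subset[OF assms(1)]] f(2) by simp
  then show ?thesis
    using graph_iso_inv[OF f(1)] unfolding graphlet_iso_def by blast
qed

lemma graphlet_iso_initial_segment:
  fixes X :: "'a graphlet"
  assumes X: "is_graphlet s X"
  shows "\<exists>Y :: nat graphlet. is_graphlet s Y \<and> verts (fst Y) = {..<s} \<and> graphlet_iso X Y"
proof -
  obtain H x where H: "fst X = H" "snd X = aut_orbit H x" "x \<in> verts H"
    "simple_graph H" "connected_graph H" "card (verts H) = s"
    using X unfolding is_graphlet_def by blast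
  obtain f where b: "bij_betw f (verts H) {..<s}"
    using H(4,6) ex_bij_betw_finite_nat unfolding simple_graph_def atLeast0LessThan[symmetric]
    by metis
  define K where "K = Graph {..<s} ((`) f ` edges H)"
  have inj: "inj_on f (verts H)" using b by (rule bij_betw_imp_inj_on)
  have sub: "e \<subseteq> verts H" "card e = 2" if "e \<in> edges H" for e
    using that H(4) unfolding simple_graph_def by auto
  have "{u, w} \<in> edges H \<longleftrightarrow> {f u, f w} \<in> edges K" if uw: "u \<in> verts H" "w \<in> verts H" for u w
  proof
    assume "{u, w} \<in> edges H"
    then have "f ` {u, w} \<in> edges K" unfolding K_def graph.sel by (rule imageI)
    then show "{f u, f w} \<in> edges K" by simp
  next
    assume "{f u, f w} \<in> edges K"
    then obtain e where e: "e \<in> edges H" "f ` e = f ` {u, w}"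
      unfolding K_def by auto
    then have "e = {u, w}"
      using inj_on_image_eq_iff[OF inj, of e "{u, w}"] sub(1) uw by auto
    then show "{u, w} \<in> edges H" using e by simp
  qed
  then have f: "graph_iso f H K" using b unfolding graph_iso_def K_def by simp
  have "simple_graph K"
    unfolding simple_graph_def
  proof (intro conjI ballI)
    show "finite (verts K)" unfolding K_def by simp
    fix e assume "e \<in> edges K"
    then obtain d where d: "d \<in> edges H" "e = f ` d" unfolding K_def by auto
    show "e \<subseteq> verts K" using d sub(1)[OF d(1)] b unfolding K_def bij_betw_def by auto
    show "card e = 2" using d sub[OF d(1)] card_image[OF inj_on_subset[OF inj]] by metis
  qed
  moreover have "connected_graph K"
    unfolding connected_graph_def
  proof (intro conjI ballI)
    show "verts K \<noteq> {}" using b H(3) unfolding K_def bij_betw_def by auto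
    fix u w assume "u \<in> verts K" "w \<in> verts K"
    then obtain u' w' where u': "u' \<in> verts H" "u = f u'" and w': "w' \<in> verts H" "w = f w'"
      using bij_betw_imp_surj_on[OF b] unfolding K_def graph.sel by blast
    have "(u', w') \<in> {(x, y). {x, y} \<in> edges H}\<^sup>*"
      using H(5) u' w' unfolding connected_graph_def by blast
    then have "(f u', f w') \<in> {(x, y). {x, y} \<in> edges K}\<^sup>*"
    proof (induction rule: rtrancl_induct)
      case base
      then show ?case by simp
    next
      case (step y z)
      then have "f ` {y, z} \<in> edges K" unfolding K_def graph.sel by blast
      then have "(f y, f z) \<in> {(x, y). {x, y} \<in> edges K}" by simp
      then show ?case using step.IH by (rule rtrancl_into_rtrancl[rotated])
    qed
    then show "(u, w) \<in> {(x, y). {x, y} \<in> edges K}\<^sup>*" using u' w' by simp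
  qed
  moreover have "f x \<in> verts K" using b H(3) unfolding K_def by (auto dest: bij_betwE)
  moreover have "verts K = {..<s}" unfolding K_def by simp
  ultimately have "is_graphlet s (K, aut_orbit K (f x))"
    unfolding is_graphlet_def by simp
  moreover have "graphlet_iso X (K, aut_orbit K (f x))"
    using f graph_iso_image_aut_orbit[OF f H(3)] H(1,2) unfolding graphlet_iso_def by auto
  ultimately show ?thesis using \<open>verts K = {..<s}\<close> by (metis fst_conv)
qed

lemma finite_graphlets_initial_segment:
  "finite {Y :: nat graphlet. is_graphlet s Y \<and> verts (fst Y) = {..<s}}" (is "finite ?A")
proof (rule finite_subset)
  show "?A \<subseteq> (\<lambda>(E, \<sigma>). (Graph {..<s} E, \<sigma>)) ` (Pow (Pow {..<s}) \<times> Pow {..<s})"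
  proof
    fix Y assume Y: "Y \<in> ?A"
    have "snd Y \<subseteq> {..<s}" using Y is_graphlet_orbit_subset[of s Y] by simp
    moreover have "edges (fst Y) \<subseteq> Pow {..<s}"
      using Y unfolding is_graphlet_def simple_graph_def by blast
    moreover have "Y = (Graph {..<s} (edges (fst Y)), snd Y)"
      using Y by (simp add: prod_eq_iff graph.expand)
    ultimately show "Y \<in> (\<lambda>(E, \<sigma>). (Graph {..<s} E, \<sigma>)) ` (Pow (Pow {..<s}) \<times> Pow {..<s})"
      by (intro image_eqI[where x = "(edges (fst Y), snd Y)"]) simp_all
  qed
next
  show "finite ((\<lambda>(E, \<sigma>). (Graph {..<s} E, \<sigma>)) ` (Pow (Pow {..<s}) \<times> Pow {..<s}))"
    by (intro finite_imageI finite_cartesian_product finite_Pow_iff[THEN iffD2] finite_lessThan)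
qed

lemma graphlet_family_exists: "\<exists>Xs. graphlet_family s Xs"
proof -
  define A where "A = {Y :: nat graphlet. is_graphlet s Y \<and> verts (fst Y) = {..<s}}"
  define rep where "rep X = (SOME Y. Y \<in> A \<and> graphlet_iso X Y)" for X :: "nat graphlet"
  have rep: "rep X \<in> A \<and> graphlet_iso X (rep X)" if "is_graphlet s X" for X
    using someI_ex[of "\<lambda>Y. Y \<in> A \<and> graphlet_iso X Y"] graphlet_iso_initial_segment[OF that]
    unfolding rep_def A_def by blast
  have rep_eq: "rep X = rep Y" if "is_graphlet s X" "graphlet_iso X Y" for X Y
  proof -
    have "graphlet_iso X Z \<longleftrightarrow> graphlet_iso Y Z" for Z :: "nat graphlet"
      using that graphlet_iso_trans graphlet_iso_sym by blast
    then show ?thesis unfolding rep_def by simp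
  qed
  have "finite (rep ` A)"
    using finite_graphlets_initial_segment[of s] unfolding A_def by simp
  then obtain Xs where Xs: "set Xs = rep ` A" "distinct Xs"
    using finite_distinct_list[of "rep ` A"] by metis
  have A: "is_graphlet s X" if "X \<in> A" for X using that unfolding A_def by simp
  have "\<exists>!i. i < length Xs \<and> graphlet_iso X (Xs ! i)" if X: "is_graphlet s X" for X :: "nat graphlet"
  proof -
    have repX: "rep X = rep (rep X)" "rep X \<in> A" using rep_eq[OF X] rep[OF X] by blast+
    then have "rep X \<in> set Xs" unfolding Xs(1) by blast
    then obtain i where i: "i < length Xs" "Xs ! i = rep X" by (auto simp: in_set_conv_nth)
    show ?thesis
    proof (rule ex1I[of _ i])
      show "i < length Xs \<and> graphlet_iso X (Xs ! i)" using i rep[OF X] by simp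
    next
      fix j assume j: "j < length Xs \<and> graphlet_iso X (Xs ! j)"
      then have "Xs ! j \<in> rep ` A" using Xs(1) nth_mem by blast
      then obtain Y where Y: "Y \<in> A" "Xs ! j = rep Y" by blast
      have "rep X = rep (rep Y)" using rep_eq[OF X, of "rep Y"] j Y(2) by metis
      also have "\<dots> = rep Y" using rep_eq[OF A[OF Y(1)], of "rep Y"] rep[OF A[OF Y(1)]] by metis
      finally have "Xs ! j = Xs ! i" using i Y by simp
      then show "j = i" using nth_eq_iff_index_eq[OF Xs(2)] i(1) j by blast
    qed
  qed
  moreover have "\<forall>X\<in>set Xs. is_graphlet s X"
  proof
    fix X assume "X \<in> set Xs"
    then obtain Y where "Y \<in> A" "X = rep Y" unfolding Xs(1) by blast
    then have "X \<in> A" using rep[OF A[of Y]] by simp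
    then show "is_graphlet s X" by (rule A)
  qed
  ultimately have "graphlet_family s Xs" unfolding graphlet_family_def by simp
  then show ?thesis by (rule exI)
qed

end

theory Submission
  imports Defs
begin

text \<open>
  Both parts are double counts of nested pairs \<open>H \<subseteq> K \<subseteq> G\<close> of connected \<open>s\<close>-vertex graphs through
  \<open>v\<close>, grouped by the class of \<open>K\<close>; the number of \<open>H\<close> inside \<open>K\<close> depends only on that class, which
  makes it an entry of \<open>U\<close>. For (a), \<open>K\<close> runs over induced subgraphs, and each \<open>H\<close> lies in exactly
  one of them on its own vertex set. For (b), \<open>G\<close> itself has \<open>s\<close> vertices and \<open>K\<close> is
  weighted by \<open>(-1)\<close> to the number of its edges. Every edge set between those of \<open>H\<close> and \<open>G\<close> gives a
  connected \<open>K\<close>, so the alternating sum over \<open>K\<close> vanishes unless \<open>H = G\<close>.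
\<close>

section \<open>Transport along isomorphisms\<close>

text \<open>Edges of a simple graph are two-element sets of vertices, so the pairwise condition in
  \<open>graph_iso\<close> determines the whole edge set.\<close>

lemma graph_iso_edges:
  assumes f: "graph_iso f H K" and H: "simple_graph H" and K: "simple_graph K"
  shows "edges K = (`) f ` edges H"
proof (intro equalityI subsetI)
  have b: "f ` verts H = verts K"
    using f unfolding graph_iso_def bij_betw_def by blast
  fix e assume e: "e \<in> edges K"
  then have "e \<subseteq> verts K" "card e = 2" using K unfolding simple_graph_def by auto
  then obtain x y where xy: "e = {x, y}" "x \<in> verts K" "y \<in> verts K"
    by (auto simp: card_2_iff)
  then obtain u w where uw: "u \<in> verts H" "w \<in> verts H" "x = f u" "y = f w"
    using b by (metis imageE)
  then have "{u, w} \<in> edges H" using f e xy(1) unfolding graph_iso_def by blast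
  then show "e \<in> (`) f ` edges H" using xy(1) uw by (intro image_eqI[of _ _ "{u, w}"]) auto
next
  fix e assume "e \<in> (`) f ` edges H"
  then obtain d where d: "d \<in> edges H" "e = f ` d" by blast
  then have "d \<subseteq> verts H" "card d = 2" using H unfolding simple_graph_def by auto
  then obtain x y where "d = {x, y}" "x \<in> verts H" "y \<in> verts H"
    by (auto simp: card_2_iff)
  then show "e \<in> edges K" using f d unfolding graph_iso_def by auto
qed

lemma simple_graph_edges_subset: "simple_graph H \<Longrightarrow> edges H \<subseteq> Pow (verts H)"
  unfolding simple_graph_def by blast

lemma simple_graph_finite_edges: "simple_graph H \<Longrightarrow> finite (edges H)"
  using simple_graph_edges_subset[of H] finite_subset unfolding simple_graph_def by blast

lemma graph_iso_card_edges:
  assumes f: "graph_iso f H K" and H: "simple_graph H" and K: "simple_graph K"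
  shows "card (edges K) = card (edges H)"
proof -
  have "inj_on f (verts H)" using f unfolding graph_iso_def bij_betw_def by blast
  then have "inj_on ((`) f) (edges H)"
    using inj_on_image_Pow simple_graph_edges_subset[OF H] inj_on_subset by blast
  then show ?thesis unfolding graph_iso_edges[OF assms] by (rule card_image)
qed

lemma graph_iso_connected:
  assumes f: "graph_iso f H K" and H: "simple_graph H" "connected_graph H"
  shows "connected_graph K"
  unfolding connected_graph_def
proof (intro conjI ballI)
  have b: "f ` verts H = verts K"
    using f unfolding graph_iso_def bij_betw_def by blast
  show "verts K \<noteq> {}" using H(2) b unfolding connected_graph_def by blast
  fix u w assume "u \<in> verts K" "w \<in> verts K"
  then obtain x y where x: "x \<in> verts H" "u = f x" and y: "y \<in> verts H" "w = f y"
    using b by blast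
  have "(x, y) \<in> {(x, y). {x, y} \<in> edges H}\<^sup>*"
    using H(2) x y unfolding connected_graph_def by blast
  then have "(f x, f y) \<in> {(x, y). {x, y} \<in> edges K}\<^sup>*"
  proof (induction rule: rtrancl_induct)
    case (step y z)
    then have "{y, z} \<in> edges H" by simp
    moreover have "y \<in> verts H" "z \<in> verts H"
      using calculation simple_graph_edges_subset[OF H(1)] by auto
    ultimately have "{f y, f z} \<in> edges K" using f unfolding graph_iso_def by blast
    then show ?case using step.IH by (simp add: rtrancl_into_rtrancl)
  qed simp
  then show "(u, w) \<in> {(x, y). {x, y} \<in> edges K}\<^sup>*" using x y by simp
qed

text \<open>Adding edges on a fixed vertex set keeps every path. This makes the induced subgraph of
  part (a) and all intermediate graphs of part (b) connected.\<close>

lemma connected_graph_mono: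
  assumes "connected_graph H" "verts K = verts H" "edges H \<subseteq> edges K"
  shows "connected_graph K"
proof -
  have "{(x, y). {x, y} \<in> edges H}\<^sup>* \<subseteq> {(x, y). {x, y} \<in> edges K}\<^sup>*"
    using assms(3) by (intro rtrancl_mono) auto
  then show ?thesis using assms(1,2) unfolding connected_graph_def by auto
qed

text \<open>While \<open>graph_iso\<close> compares two given graphs, this builds the target, so
  that subgraphs can be pushed along an isomorphism of their ambient graph.\<close>

definition graph_image :: "('a \<Rightarrow> 'b) \<Rightarrow> 'a graph \<Rightarrow> 'b graph" where
  "graph_image f H = Graph (f ` verts H) ((`) f ` edges H)"

lemma graph_iso_graph_image:
  assumes inj: "inj_on f (verts H)" and H: "simple_graph H"
  shows "graph_iso f H (graph_image f H)"
proof -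
  have "{u, w} \<in> edges H" if uw: "u \<in> verts H" "w \<in> verts H" and im: "{f u, f w} \<in> (`) f ` edges H"
    for u w
  proof -
    obtain e where e: "e \<in> edges H" "f ` e = f ` {u, w}" using im by auto
    then have "e = {u, w}"
      using inj_on_image_eq_iff[OF inj, of e "{u, w}"] simple_graph_edges_subset[OF H] uw by auto
    then show ?thesis using e by simp
  qed
  moreover have "{f u, f w} \<in> (`) f ` edges H" if "{u, w} \<in> edges H" for u w
    using that by (intro image_eqI[of _ _ "{u, w}"]) auto
  ultimately show ?thesis
    using inj unfolding graph_iso_def graph_image_def by (auto simp: bij_betw_def)
qed

lemma simple_graph_image:
  assumes inj: "inj_on f (verts H)" and H: "simple_graph H"
  shows "simple_graph (graph_image f H)"
  unfolding simple_graph_def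
proof (intro conjI ballI)
  show "finite (verts (graph_image f H))"
    using H unfolding simple_graph_def graph_image_def by simp
  fix e assume "e \<in> edges (graph_image f H)"
  then obtain d where d: "d \<in> edges H" "e = f ` d" unfolding graph_image_def by auto
  then have d': "d \<subseteq> verts H" "card d = 2" using H unfolding simple_graph_def by auto
  show "e \<subseteq> verts (graph_image f H)" using d d' unfolding graph_image_def by auto
  show "card e = 2" using d(2) d' card_image[OF inj_on_subset[OF inj]] by metis
qed

section \<open>Finiteness and isomorphism invariance of gross counts\<close>

lemma finite_subgraphs:
  assumes "simple_graph G"
  shows "finite {H. subgraph_of H G}"
proof (rule finite_subset)
  show "{H. subgraph_of H G} \<subseteq> (\<lambda>(V, E). Graph V E) ` (Pow (verts G) \<times> Pow (edges G))"
  proof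
    fix H assume "H \<in> {H. subgraph_of H G}"
    then show "H \<in> (\<lambda>(V, E). Graph V E) ` (Pow (verts G) \<times> Pow (edges G))"
      unfolding subgraph_of_def by (cases H) auto
  qed
  show "finite ((\<lambda>(V, E). Graph V E) ` (Pow (verts G) \<times> Pow (edges G)))"
    using assms simple_graph_finite_edges[OF assms] unfolding simple_graph_def by simp
qed

text \<open>The map \<open>graph_image f\<close> sends the subgraphs counted at \<open>v\<close>
  injectively to subgraphs counted at \<open>f v\<close>. An inequality is enough here, since the
  inverse isomorphism supplies the other one.\<close>

lemma gross_count_le_graph_iso:
  assumes f: "graph_iso f G K" and G: "simple_graph G" and K: "simple_graph K"
  shows "gross_count X G v \<le> gross_count X K (f v)"
  unfolding gross_count_def
proof (rule card_inj_on_le[where f = "graph_image f"])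
  have inj: "inj_on f (verts G)" and im: "f ` verts G = verts K"
    using f unfolding graph_iso_def bij_betw_def by auto
  let ?A = "{H. subgraph_of H G \<and> v \<in> verts H \<and> graphlet_iso X (H, aut_orbit H v)}"
  let ?B = "{H. subgraph_of H K \<and> f v \<in> verts H \<and> graphlet_iso X (H, aut_orbit H (f v))}"
  show "inj_on (graph_image f) ?A"
  proof (rule inj_onI)
    fix H L assume "H \<in> ?A" "L \<in> ?A" and eq: "graph_image f H = graph_image f L"
    then have H: "verts H \<subseteq> verts G" "edges H \<subseteq> Pow (verts G)"
      and L: "verts L \<subseteq> verts G" "edges L \<subseteq> Pow (verts G)"
      using simple_graph_edges_subset[OF G] unfolding subgraph_of_def by auto
    have "verts H = verts L"
      using eq inj_on_image_eq_iff[OF inj H(1) L(1)] unfolding graph_image_def by simp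
    moreover have "edges H = edges L"
      using eq inj_on_image_eq_iff[OF inj_on_image_Pow[OF inj] H(2) L(2)]
      unfolding graph_image_def by simp
    ultimately show "H = L" by (simp add: graph.expand)
  qed
  show "graph_image f ` ?A \<subseteq> ?B"
  proof clarify
    fix H assume H: "subgraph_of H G" "v \<in> verts H" "graphlet_iso X (H, aut_orbit H v)"
    have injH: "inj_on f (verts H)" and sH: "simple_graph H"
      using H(1) inj inj_on_subset unfolding subgraph_of_def by blast+
    note iso = graph_iso_graph_image[OF injH sH]
    have "graphlet_iso (H, aut_orbit H v) (graph_image f H, aut_orbit (graph_image f H) (f v))"
      using iso graph_iso_image_aut_orbit[OF iso H(2)] unfolding graphlet_iso_def by auto
    moreover have "verts (graph_image f H) \<subseteq> verts K" "edges (graph_image f H) \<subseteq> edges K"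
      using H(1) graph_iso_edges[OF f G K] unfolding subgraph_of_def graph_image_def
      by (auto simp: im[symmetric])
    then have "subgraph_of (graph_image f H) K"
      using simple_graph_image[OF injH sH] unfolding subgraph_of_def by blast
    moreover have "f v \<in> verts (graph_image f H)"
      using H(2) unfolding graph_image_def by simp
    ultimately show "subgraph_of (graph_image f H) K \<and> f v \<in> verts (graph_image f H) \<and>
        graphlet_iso X (graph_image f H, aut_orbit (graph_image f H) (f v))"
      using graphlet_iso_trans[OF H(3)] by blast
  qed
  show "finite ?B" by (rule finite_subset[OF _ finite_subgraphs[OF K]]) auto
qed

lemma gross_count_graph_iso:
  assumes f: "graph_iso f G K" and G: "simple_graph G" and K: "simple_graph K" and v: "v \<in> verts G"
  shows "gross_count X K (f v) = gross_count X G v"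
proof -
  have "bij_betw f (verts G) (verts K)" using f unfolding graph_iso_def by blast
  then have "inv_into (verts G) f (f v) = v" using v by (rule bij_betw_inv_into_left)
  then have "gross_count X K (f v) \<le> gross_count X G v"
    using gross_count_le_graph_iso[OF graph_iso_inv[OF f] K G, of X "f v"] by simp
  then show ?thesis using gross_count_le_graph_iso[OF f G K, of X v] by simp
qed

section \<open>Graphlets and their classes\<close>

lemma graph_iso_id: "graph_iso (\<lambda>x. x) H H"
  unfolding graph_iso_def bij_betw_def by simp

lemma aut_orbit_refl: "x \<in> aut_orbit H x"
  unfolding aut_orbit_def using graph_iso_id[of H] by (metis (mono_tags, lifting) mem_Collect_eq)

text \<open>Automorphisms are closed under composition and inversion, so lying in the orbit of one
  another is a symmetric and transitive relation on the vertices.\<close>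

lemma aut_orbit_eq:
  assumes x: "x \<in> verts H" and y: "y \<in> aut_orbit H x"
  shows "aut_orbit H y = aut_orbit H x"
proof -
  have le: "aut_orbit H b \<subseteq> aut_orbit H a" if "b \<in> aut_orbit H a" for a b
  proof
    obtain f where f: "graph_iso f H H" "b = f a"
      using \<open>b \<in> aut_orbit H a\<close> unfolding aut_orbit_def by blast
    fix z assume "z \<in> aut_orbit H b"
    then obtain g where g: "graph_iso g H H" "z = g b" unfolding aut_orbit_def by blast
    have "z = (g \<circ> f) a" using f g by simp
    then show "z \<in> aut_orbit H a"
      using graph_iso_comp[OF f(1) g(1)] unfolding aut_orbit_def by blast
  qed
  obtain f where f: "graph_iso f H H" "y = f x" using y unfolding aut_orbit_def by blast
  have "inv_into (verts H) f y = x"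
    using f x bij_betw_inv_into_left unfolding graph_iso_def by metis
  then have "x \<in> aut_orbit H y"
    using graph_iso_inv[OF f(1)] unfolding aut_orbit_def by blast
  then show ?thesis using le y by blast
qed

text \<open>Any vertex of the designated orbit generates it; this is what makes the choice of
  \<open>r\<close> in \<open>U_mat\<close> arbitrary.\<close>

lemma is_graphlet_orbit:
  assumes X: "is_graphlet s X" and r: "r \<in> snd X"
  shows "snd X = aut_orbit (fst X) r" "r \<in> verts (fst X)"
proof -
  obtain x where x: "x \<in> verts (fst X)" "snd X = aut_orbit (fst X) x"
    using X unfolding is_graphlet_def by blast
  then show "snd X = aut_orbit (fst X) r" using aut_orbit_eq r by metis
  show "r \<in> verts (fst X)" using is_graphlet_orbit_subset[OF X] r by blast
qed

text \<open>An isomorphism of graphlets matches orbits only: it sends \<open>r\<close> to some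
  vertex in the orbit of \<open>v\<close>. Composing with the inverse of an automorphism of
  \<open>K\<close> that moves \<open>v\<close> there makes it send \<open>r\<close> to
  \<open>v\<close> itself.\<close>

lemma graphlet_iso_pointed:
  assumes r: "r \<in> snd X" and v: "v \<in> verts K"
    and iso: "graphlet_iso X (K, aut_orbit K v)"
  obtains f where "graph_iso f (fst X) K" "f r = v"
proof -
  obtain f where f: "graph_iso f (fst X) K" "f ` snd X = aut_orbit K v"
    using iso unfolding graphlet_iso_def by auto
  then obtain a where a: "graph_iso a K K" "f r = a v"
    using r unfolding aut_orbit_def by blast
  have "inv_into (verts K) a (a v) = v"
    using a v bij_betw_inv_into_left unfolding graph_iso_def by metis
  then have "(inv_into (verts K) a \<circ> f) r = v" using a by simp
  then show ?thesis using that graph_iso_comp[OF f(1) graph_iso_inv[OF a(1)]] by blast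
qed

text \<open>These are the pairs of a graph and a vertex that have a class among the
  \<open>s\<close>-node graphlets. The predicate fixes the range of the intermediate graph
  \<open>K\<close> before any class is chosen.\<close>

definition connected_at :: "nat \<Rightarrow> 'a graph \<Rightarrow> 'a \<Rightarrow> bool" where
  "connected_at s K v \<longleftrightarrow>
     simple_graph K \<and> connected_graph K \<and> card (verts K) = s \<and> v \<in> verts K"

lemma connected_atI:
  assumes X: "is_graphlet s X" and iso: "graphlet_iso X (K, \<sigma>)"
    and K: "simple_graph K" and v: "v \<in> verts K"
  shows "connected_at s K v"
proof -
  obtain f where f: "graph_iso f (fst X) K" using iso unfolding graphlet_iso_def by auto
  have "card (verts K) = s"
    using f X bij_betw_same_card unfolding graph_iso_def is_graphlet_def by metis
  then show ?thesis
    using graph_iso_connected[OF f] X K v unfolding connected_at_def is_graphlet_def by blast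
qed

text \<open>Connectedness and size are inherited from \<open>X\<close>, so the sets in the
  definitions of both counts can be rewritten as classes inside a set of \<open>connected_at\<close>
  graphs.\<close>

lemma connected_at_iff:
  assumes "is_graphlet s X" and "graphlet_iso X (K, aut_orbit K v)"
  shows "connected_at s K v \<longleftrightarrow> simple_graph K \<and> v \<in> verts K"
  using connected_atI[OF assms] unfolding connected_at_def by blast

lemma connected_at_is_graphlet:
  "connected_at s K v \<Longrightarrow> is_graphlet s (K, aut_orbit K v)"
  unfolding connected_at_def is_graphlet_def by simp

text \<open>The family classifies graphlets on natural numbers only, whereas \<open>K\<close> may
  have any vertex type. A copy \<open>Y\<close> of \<open>K\<close> on an initial segment of the
  naturals carries the classification over.\<close>

lemma graphlet_family_class:
  assumes fam: "graphlet_family s Xs" and K: "connected_at s K v"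
  shows "\<exists>!j. j < length Xs \<and> graphlet_iso (Xs ! j) (K, aut_orbit K v)"
proof -
  let ?Z = "(K, aut_orbit K v)"
  have Z: "is_graphlet s ?Z" using K by (rule connected_at_is_graphlet)
  obtain Y :: "nat graphlet" where Y: "is_graphlet s Y" "graphlet_iso ?Z Y"
    using graphlet_iso_initial_segment[OF Z] by blast
  have "graphlet_iso Y (Xs ! j) \<longleftrightarrow> graphlet_iso (Xs ! j) ?Z" if j: "j < length Xs" for j
  proof -
    have Xj: "is_graphlet s (Xs ! j)" using fam j unfolding graphlet_family_def by simp
    show ?thesis
      using graphlet_iso_sym[OF Y(1)] graphlet_iso_sym[OF Xj] graphlet_iso_sym[OF Z]
        graphlet_iso_trans Y(2) by metis
  qed
  moreover have "\<exists>!j. j < length Xs \<and> graphlet_iso Y (Xs ! j)"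
    using fam Y(1) unfolding graphlet_family_def by blast
  ultimately show ?thesis by metis
qed

section \<open>Double counting\<close>

text \<open>The classes partition \<open>T\<close>, and \<open>h\<close> is constant on the class of
  index \<open>j\<close> with value \<open>F j\<close>. An empty class contributes 0 whatever
  \<open>F j\<close> is.\<close>

lemma sum_over_classes:
  fixes F :: "nat \<Rightarrow> real"
  assumes fam: "graphlet_family s Xs" and T: "finite T" "\<And>K. K \<in> T \<Longrightarrow> connected_at s K v"
    and F: "\<And>j K. \<lbrakk>j < length Xs; K \<in> T; graphlet_iso (Xs ! j) (K, aut_orbit K v)\<rbrakk> \<Longrightarrow> F j = h K"
  shows "(\<Sum>j<length Xs. F j * real (card {K \<in> T. graphlet_iso (Xs ! j) (K, aut_orbit K v)})) =
    (\<Sum>K\<in>T. h K)"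
proof -
  define C where "C j = {K \<in> T. graphlet_iso (Xs ! j) (K, aut_orbit K v)}" for j
  have "(\<Sum>K\<in>T. h K) = sum h (\<Union>j<length Xs. C j)"
  proof (rule sum.cong)
    show "T = (\<Union>j<length Xs. C j)"
      using graphlet_family_class[OF fam T(2)] unfolding C_def by blast
  qed simp
  also have "\<dots> = (\<Sum>j<length Xs. sum h (C j))"
  proof (rule sum.UNION_disjoint)
    show "\<forall>i\<in>{..<length Xs}. \<forall>j\<in>{..<length Xs}. i \<noteq> j \<longrightarrow> C i \<inter> C j = {}"
      using graphlet_family_class[OF fam T(2)] unfolding C_def by blast
  qed (use T(1) in \<open>auto simp: C_def\<close>)
  also have "\<dots> = (\<Sum>j<length Xs. F j * real (card (C j)))"
  proof (rule sum.cong)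
    fix j assume "j \<in> {..<length Xs}"
    then have "sum h (C j) = (\<Sum>K\<in>C j. F j)"
      using F unfolding C_def by (intro sum.cong) auto
    then show "sum h (C j) = F j * real (card (C j))" by simp
  qed simp
  finally show ?thesis unfolding C_def by simp
qed

text \<open>The common engine of both parts: grouping by classes turns the left side into a weighted
  count of pairs with \<open>H\<close> inside \<open>K\<close>, and the order of summation is then
  exchanged. The weight depends only on the number of edges, hence only on the class. Part (a) uses
  weight 1, part (b) the sign.\<close>

lemma weighted_double_count:
  fixes X :: "'c graphlet" and \<mu> :: "nat \<Rightarrow> real"
  assumes fam: "graphlet_family s Xs" and r: "\<And>j. j < length Xs \<Longrightarrow> r j \<in> snd (Xs ! j)"
    and G: "simple_graph G"
    and T: "\<And>K. K \<in> T \<Longrightarrow> subgraph_of K G \<and> connected_at s K v"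
  shows "(\<Sum>j<length Xs. real (gross_count X (fst (Xs ! j)) (r j)) * \<mu> (card (edges (fst (Xs ! j)))) *
            real (card {K \<in> T. graphlet_iso (Xs ! j) (K, aut_orbit K v)})) =
    (\<Sum>H | subgraph_of H G \<and> v \<in> verts H \<and> graphlet_iso X (H, aut_orbit H v).
       \<Sum>K | K \<in> T \<and> subgraph_of H K. \<mu> (card (edges K)))"
    (is "?L = ?R")
proof -
  let ?A = "\<lambda>K. {H. subgraph_of H K \<and> v \<in> verts H \<and> graphlet_iso X (H, aut_orbit H v)}"
  have finT: "finite T" using T by (intro finite_subset[OF _ finite_subgraphs[OF G]]) auto
  have finA: "finite (?A G)" by (rule finite_subset[OF _ finite_subgraphs[OF G]]) auto
  have "?L = (\<Sum>K\<in>T. real (gross_count X K v) * \<mu> (card (edges K)))"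
  proof (rule sum_over_classes[OF fam finT])
    fix K assume "K \<in> T" then show "connected_at s K v" using T by blast
  next
    fix j K assume j: "j < length Xs" and K: "K \<in> T"
      and iso: "graphlet_iso (Xs ! j) (K, aut_orbit K v)"
    have sK: "simple_graph K" and vK: "v \<in> verts K"
      using T[OF K] unfolding connected_at_def by auto
    have Xj: "is_graphlet s (Xs ! j)" using fam j unfolding graphlet_family_def by simp
    then have sX: "simple_graph (fst (Xs ! j))" unfolding is_graphlet_def by blast
    \<comment> \<open>The gross count is taken at a vertex, so the isomorphism must carry
      \<open>r j\<close> exactly to \<open>v\<close>.\<close>
    obtain f where f: "graph_iso f (fst (Xs ! j)) K" "f (r j) = v"
      using graphlet_iso_pointed[OF r[OF j] vK iso] .
    show "real (gross_count X (fst (Xs ! j)) (r j)) * \<mu> (card (edges (fst (Xs ! j)))) =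
        real (gross_count X K v) * \<mu> (card (edges K))"
      using gross_count_graph_iso[OF f(1) sX sK is_graphlet_orbit(2)[OF Xj r[OF j]], of X]
        graph_iso_card_edges[OF f(1) sX sK] f(2) by simp
  qed
  also have "\<dots> = (\<Sum>K\<in>T. \<Sum>H | H \<in> ?A G \<and> subgraph_of H K. \<mu> (card (edges K)))"
  proof (rule sum.cong)
    fix K assume K: "K \<in> T"
    \<comment> \<open>Since \<open>K\<close> lies in \<open>G\<close>, the inner index set is cut
      out of one set independent of \<open>K\<close>, as the exchange of sums requires.\<close>
    have "?A K = {H. H \<in> ?A G \<and> subgraph_of H K}"
      using T[OF K] unfolding subgraph_of_def by blast
    then show "real (gross_count X K v) * \<mu> (card (edges K)) =
        (\<Sum>H | H \<in> ?A G \<and> subgraph_of H K. \<mu> (card (edges K)))"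
      unfolding gross_count_def by simp
  qed simp
  also have "\<dots> = (\<Sum>H\<in>?A G. \<Sum>K | K \<in> T \<and> subgraph_of H K. \<mu> (card (edges K)))"
    by (rule sum.swap_restrict[OF finT finA])
  finally show ?thesis by simp
qed

section \<open>Part (a), row by row\<close>

lemma gross_count_eq_sum_net_count:
  fixes X :: "'c graphlet"
  assumes fam: "graphlet_family s Xs" and r: "\<And>j. j < length Xs \<Longrightarrow> r j \<in> snd (Xs ! j)"
    and X: "is_graphlet s X" and G: "simple_graph G"
  shows "(\<Sum>j<length Xs. real (gross_count X (fst (Xs ! j)) (r j)) * real (net_count (Xs ! j) G v)) =
    real (gross_count X G v)"
proof -
  define T where "T = {K. induced_subgraph_of K G \<and> connected_at s K v}"
  let ?A = "{H. subgraph_of H G \<and> v \<in> verts H \<and> graphlet_iso X (H, aut_orbit H v)}"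
  have "net_count (Xs ! j) G v = card {K \<in> T. graphlet_iso (Xs ! j) (K, aut_orbit K v)}"
    if j: "j < length Xs" for j
  proof -
    have Xj: "is_graphlet s (Xs ! j)" using fam j unfolding graphlet_family_def by simp
    have "{H. induced_subgraph_of H G \<and> v \<in> verts H \<and> graphlet_iso (Xs ! j) (H, aut_orbit H v)} =
        {K \<in> T. graphlet_iso (Xs ! j) (K, aut_orbit K v)}"
      unfolding T_def induced_subgraph_of_def subgraph_of_def
      by (intro Collect_cong) (auto simp: connected_at_iff[OF Xj])
    then show ?thesis unfolding net_count_def by simp
  qed
  then have "(\<Sum>j<length Xs. real (gross_count X (fst (Xs ! j)) (r j)) * real (net_count (Xs ! j) G v)) =
      (\<Sum>j<length Xs. real (gross_count X (fst (Xs ! j)) (r j)) * 1 *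
            real (card {K \<in> T. graphlet_iso (Xs ! j) (K, aut_orbit K v)}))"
    by (intro sum.cong) auto
  also have "\<dots> = (\<Sum>H\<in>?A. \<Sum>K | K \<in> T \<and> subgraph_of H K. 1)"
    by (rule weighted_double_count[OF fam r G, where \<mu> = "\<lambda>_. 1"])
      (auto simp: T_def induced_subgraph_of_def)
  also have "\<dots> = (\<Sum>H\<in>?A. 1)"
  proof (rule sum.cong)
    fix H assume H: "H \<in> ?A"
    then have sH: "simple_graph H" and HG: "verts H \<subseteq> verts G" "edges H \<subseteq> edges G"
      unfolding subgraph_of_def by auto
    have cH: "connected_at s H v"
      using connected_atI[OF X, of H "aut_orbit H v" v] H sH by simp
    \<comment> \<open>The subgraph of \<open>G\<close> induced on the vertices of \<open>H\<close>
      is the unique member of \<open>T\<close> containing \<open>H\<close>.\<close>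
    define I where "I = Graph (verts H) {e \<in> edges G. e \<subseteq> verts H}"
    have HI: "verts I = verts H" "edges H \<subseteq> edges I"
      using HG simple_graph_edges_subset[OF sH] unfolding I_def by auto
    have sI: "simple_graph I"
      using G sH unfolding simple_graph_def I_def by auto
    have "I \<in> T"
      using sI HI HG cH connected_graph_mono[OF _ HI]
      unfolding T_def induced_subgraph_of_def subgraph_of_def connected_at_def
      by (auto simp: I_def)
    moreover have "subgraph_of H I" using sH HI unfolding subgraph_of_def by simp
    moreover have "K = I" if K: "K \<in> T" "subgraph_of H K" for K
    proof -
      \<comment> \<open>Both graphs have \<open>s\<close> vertices, so containment forces equal
        vertex sets, and an induced subgraph is determined by its vertices.\<close>
      have "finite (verts K)" "verts H \<subseteq> verts K" "card (verts K) = card (verts H)"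
        using K cH unfolding T_def connected_at_def subgraph_of_def simple_graph_def by auto
      then have "verts K = verts H" using card_subset_eq by metis
      then show ?thesis
        using K(1) unfolding T_def induced_subgraph_of_def I_def by (simp add: graph.expand)
    qed
    ultimately have "{K. K \<in> T \<and> subgraph_of H K} = {I}" by blast
    then show "(\<Sum>K | K \<in> T \<and> subgraph_of H K. 1) = (1 :: real)" by simp
  qed simp
  finally show ?thesis unfolding gross_count_def by simp
qed

section \<open>Alternating sums and part (b), entry by entry\<close>

lemma sum_Pow_neg_one_power_card:
  assumes "finite D"
  shows "(\<Sum>S\<in>Pow D. (-1 :: 'a :: comm_ring_1) ^ card S) = (if D = {} then 1 else 0)"
proof -
  \<comment> \<open>Expanding the product picks -1 on \<open>S\<close> and 1 off \<open>S\<close>;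
    it is 0 unless \<open>D\<close> is empty.\<close>
  have "(\<Sum>S\<in>Pow D. (-1 :: 'a) ^ card S) = (\<Prod>x\<in>D. - 1 + 1)"
    using prod_add[OF assms, of "\<lambda>_. - 1 :: 'a" "\<lambda>_. 1"] by simp
  then show ?thesis using assms by (simp add: power_0_left)
qed

text \<open>Writing \<open>E\<close> as the disjoint union of \<open>A\<close> and a subset of
  \<open>B - A\<close> pulls out the sign of \<open>A\<close> and leaves the sum over a full power
  set.\<close>

lemma sum_intermediate_neg_one_power_card:
  assumes "finite B" and "A \<subseteq> B"
  shows "(\<Sum>E | A \<subseteq> E \<and> E \<subseteq> B. (-1 :: 'a :: comm_ring_1) ^ card E) =
    (if A = B then (-1) ^ card B else 0)"
proof -
  have "(\<Sum>E | A \<subseteq> E \<and> E \<subseteq> B. (-1 :: 'a) ^ card E) =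
      (\<Sum>S\<in>Pow (B - A). (-1) ^ card A * (-1) ^ card S)"
  proof (rule sum.reindex_bij_witness[where i = "\<lambda>S. A \<union> S" and j = "\<lambda>E. E - A"])
    fix E assume E: "E \<in> {E. A \<subseteq> E \<and> E \<subseteq> B}"
    then have "card E = card A + card (E - A)"
      using assms card_Un_disjoint[of A "E - A"] finite_subset[of _ B] by (auto simp: Un_absorb1)
    then show "(-1 :: 'a) ^ card A * (-1) ^ card (E - A) = (-1) ^ card E"
      by (simp add: power_add)
  qed (use assms(2) in auto)
  also have "\<dots> = (-1) ^ card A * (if B - A = {} then 1 else 0)"
    using assms(1) by (simp add: sum_distrib_left[symmetric] sum_Pow_neg_one_power_card)
  finally show ?thesis using assms(2) by auto
qed

text \<open>With \<open>G\<close> on \<open>s\<close> vertices, all graphs in a nested pair span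
  \<open>G\<close>, so the inner sum runs over the edge sets between those of \<open>H\<close> and
  \<open>G\<close> and only \<open>H = G\<close> survives. Taking \<open>G\<close> from the family
  gives the entries of \<open>U\<close> times \<open>Lambda\<close> times \<open>U\<close>.\<close>

lemma alternating_gross_count:
  fixes X :: "'c graphlet"
  assumes fam: "graphlet_family s Xs" and r: "\<And>j. j < length Xs \<Longrightarrow> r j \<in> snd (Xs ! j)"
    and X: "is_graphlet s X" and G: "connected_at s G v"
  shows "(\<Sum>j<length Xs. real (gross_count X (fst (Xs ! j)) (r j)) *
            (-1) ^ card (edges (fst (Xs ! j))) * real (gross_count (Xs ! j) G v)) =
    (if graphlet_iso X (G, aut_orbit G v) then (-1) ^ card (edges G) else 0)"
proof -
  define T where "T = {K. subgraph_of K G \<and> connected_at s K v}"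
  let ?A = "{H. subgraph_of H G \<and> v \<in> verts H \<and> graphlet_iso X (H, aut_orbit H v)}"
  have sG: "simple_graph G" and vG: "v \<in> verts G" using G unfolding connected_at_def by auto
  have finA: "finite ?A" by (rule finite_subset[OF _ finite_subgraphs[OF sG]]) auto
  have spanning: "verts K = verts G" if "subgraph_of K G" "connected_at s K v" for K
    using that G card_subset_eq[of "verts G" "verts K"]
    unfolding subgraph_of_def connected_at_def simple_graph_def by simp
  have "gross_count (Xs ! j) G v = card {K \<in> T. graphlet_iso (Xs ! j) (K, aut_orbit K v)}"
    if j: "j < length Xs" for j
  proof -
    have Xj: "is_graphlet s (Xs ! j)" using fam j unfolding graphlet_family_def by simp
    have "{H. subgraph_of H G \<and> v \<in> verts H \<and> graphlet_iso (Xs ! j) (H, aut_orbit H v)} =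
        {K \<in> T. graphlet_iso (Xs ! j) (K, aut_orbit K v)}"
      unfolding T_def subgraph_of_def
      by (intro Collect_cong) (auto simp: connected_at_iff[OF Xj])
    then show ?thesis unfolding gross_count_def by simp
  qed
  then have "(\<Sum>j<length Xs. real (gross_count X (fst (Xs ! j)) (r j)) *
            (-1) ^ card (edges (fst (Xs ! j))) * real (gross_count (Xs ! j) G v)) =
      (\<Sum>j<length Xs. real (gross_count X (fst (Xs ! j)) (r j)) *
            (-1) ^ card (edges (fst (Xs ! j))) *
            real (card {K \<in> T. graphlet_iso (Xs ! j) (K, aut_orbit K v)}))"
    by (intro sum.cong) auto
  also have "\<dots> = (\<Sum>H\<in>?A. \<Sum>K | K \<in> T \<and> subgraph_of H K. (-1) ^ card (edges K))"
    by (rule weighted_double_count[OF fam r sG, where \<mu> = "\<lambda>m. (-1) ^ m"]) (auto simp: T_def)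
  also have "\<dots> = (\<Sum>H\<in>?A. if H = G then (-1) ^ card (edges G) else 0)"
  proof (rule sum.cong)
    fix H assume H: "H \<in> ?A"
    then have sH: "simple_graph H" and HG: "edges H \<subseteq> edges G"
      unfolding subgraph_of_def by auto
    have cH: "connected_at s H v"
      using connected_atI[OF X, of H "aut_orbit H v" v] H sH by simp
    have vH: "verts H = verts G" using spanning cH H by blast
    have "(\<Sum>K | K \<in> T \<and> subgraph_of H K. (-1 :: real) ^ card (edges K)) =
        (\<Sum>E | edges H \<subseteq> E \<and> E \<subseteq> edges G. (-1) ^ card E)"
    \<comment> \<open>A spanning \<open>K\<close> is the same as its edge set; connectedness comes
      for free because the edges of the connected graph \<open>H\<close> are included.\<close>
    proof (rule sum.reindex_bij_witness[where i = "Graph (verts G)" and j = edges])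
      fix E assume E: "E \<in> {E. edges H \<subseteq> E \<and> E \<subseteq> edges G}"
      let ?K = "Graph (verts G) E"
      have sK: "simple_graph ?K" using sG E unfolding simple_graph_def by auto
      have "connected_graph ?K"
        by (rule connected_graph_mono[of H]) (use cH vH E in \<open>auto simp: connected_at_def\<close>)
      then have "connected_at s ?K v" using sK G unfolding connected_at_def by simp
      then show "?K \<in> {K. K \<in> T \<and> subgraph_of H K}"
        using sK sH vH E unfolding T_def subgraph_of_def by simp
    next
      fix K assume "K \<in> {K. K \<in> T \<and> subgraph_of H K}"
      then show "Graph (verts G) (edges K) = K"
        using spanning unfolding T_def by (simp add: graph.expand)
    qed (auto simp: T_def subgraph_of_def)
    also have "\<dots> = (if edges H = edges G then (-1) ^ card (edges G) else 0)"
      by (rule sum_intermediate_neg_one_power_card[OF simple_graph_finite_edges[OF sG] HG])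
    also have "edges H = edges G \<longleftrightarrow> H = G" using vH by (auto simp: graph.expand)
    finally show "(\<Sum>K | K \<in> T \<and> subgraph_of H K. (-1 :: real) ^ card (edges K)) =
        (if H = G then (-1) ^ card (edges G) else 0)" .
  qed simp
  also have "\<dots> = (if G \<in> ?A then (-1) ^ card (edges G) else 0)"
    by (rule sum.delta'[OF finA, of G, simplified eq_commute[of G]])
  also have "G \<in> ?A \<longleftrightarrow> graphlet_iso X (G, aut_orbit G v)"
    using sG vG unfolding subgraph_of_def by simp
  finally show ?thesis .
qed

lemma graphlet_family_alternating:
  assumes fam: "graphlet_family s Xs" and r: "\<And>j. j < length Xs \<Longrightarrow> r j \<in> snd (Xs ! j)"
    and i: "i < length Xs" and k: "k < length Xs"
  shows "(\<Sum>j<length Xs. real (gross_count (Xs ! i) (fst (Xs ! j)) (r j)) *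
            (-1) ^ card (edges (fst (Xs ! j))) * real (gross_count (Xs ! j) (fst (Xs ! k)) (r k))) =
    (if i = k then (-1) ^ card (edges (fst (Xs ! k))) else 0)"
proof -
  have X: "is_graphlet s (Xs ! j)" if "j < length Xs" for j
    using fam that unfolding graphlet_family_def by simp
  note orb = is_graphlet_orbit[OF X[OF k] r[OF k]]
  have "connected_at s (fst (Xs ! k)) (r k)"
    using X[OF k] orb(2) unfolding connected_at_def is_graphlet_def by blast
  note alternating_gross_count[OF fam r X[OF i] this]
  moreover have "graphlet_iso (Xs ! i) (fst (Xs ! k), aut_orbit (fst (Xs ! k)) (r k)) \<longleftrightarrow>
      graphlet_iso (Xs ! i) (Xs ! k)"
    using orb(1) by (metis prod.collapse)
  \<comment> \<open>Reflexivity makes \<open>i\<close> the unique index representing the class of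
    \<open>Xs ! i\<close>.\<close>
  moreover have "graphlet_iso (Xs ! i) (Xs ! k) \<longleftrightarrow> i = k"
    using fam X[OF i] i k graphlet_iso_refl unfolding graphlet_family_def by blast
  ultimately show ?thesis by simp
qed

section \<open>Matrix form\<close>

lemma involutory_inverse:
  fixes U L :: "'a :: ring_1 mat"
  assumes U: "U \<in> carrier_mat n n" and L: "L \<in> carrier_mat n n"
    and LL: "L * L = 1\<^sub>m n" and UL: "(U * L) * (U * L) = 1\<^sub>m n"
  shows "inverts_mat U (L * U * L)" "inverts_mat (L * U * L) U"
proof -
  have "U * (L * U * L) = (U * L) * (U * L)"
    using U L by (simp add: assoc_mult_mat[of _ n n _ n _ n])
  then show "inverts_mat U (L * U * L)" using UL U unfolding inverts_mat_def by simp
  \<comment> \<open>Inserting the square of \<open>L\<close> on the far right completes a second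
    factor \<open>U * L\<close>, so that the square of \<open>U * L\<close> appears between two
    copies of \<open>L\<close>.\<close>
  have "(L * U * L) * U = (L * U * L) * (U * (L * L))" using LL U by simp
  also have "\<dots> = L * (((U * L) * (U * L)) * L)"
    using U L by (simp add: assoc_mult_mat[of _ n n _ n _ n])
  also have "\<dots> = 1\<^sub>m n" using UL LL L by simp
  finally show "inverts_mat (L * U * L) U" using L unfolding inverts_mat_def by simp
qed

lemma Lambda_mat_square: "Lambda_mat Xs * Lambda_mat Xs = 1\<^sub>m (length Xs)"
  unfolding Lambda_mat_def mat_diag_diag
  by (rule eq_matI) (auto simp: mat_diag_def power_mult_distrib[symmetric])

theorem theorem1:
  fixes s :: nat and Xs :: "nat graphlet list" and r :: "nat \<Rightarrow> nat"
  assumes "s > 1"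
    and "graphlet_family s Xs"
    and "\<And>j. j < length Xs \<Longrightarrow> r j \<in> snd (Xs ! j)"
  shows "(\<forall>(G :: 'a graph) v. simple_graph G \<longrightarrow> v \<in> verts G \<longrightarrow>
            U_mat Xs r *\<^sub>v net_vec Xs G v = gross_vec Xs G v) \<and>
         (U_mat Xs r * Lambda_mat Xs) * (U_mat Xs r * Lambda_mat Xs) = 1\<^sub>m (length Xs) \<and>
         inverts_mat (U_mat Xs r) (Lambda_mat Xs * U_mat Xs r * Lambda_mat Xs) \<and>
         inverts_mat (Lambda_mat Xs * U_mat Xs r * Lambda_mat Xs) (U_mat Xs r)"
proof -
  let ?n = "length Xs" and ?U = "U_mat Xs r" and ?L = "Lambda_mat Xs"
  have U: "?U \<in> carrier_mat ?n ?n" and L: "?L \<in> carrier_mat ?n ?n"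
    unfolding U_mat_def Lambda_mat_def by auto
  have "?U *\<^sub>v net_vec Xs G v = gross_vec Xs G v" if G: "simple_graph G" for G :: "'a graph" and v
  proof (rule eq_vecI)
    fix i assume "i < dim_vec (gross_vec Xs G v)"
    then have i: "i < ?n" unfolding gross_vec_def by simp
    then have "is_graphlet s (Xs ! i)" using assms(2) unfolding graphlet_family_def by simp
    from gross_count_eq_sum_net_count[OF assms(2,3) this G]
    show "(?U *\<^sub>v net_vec Xs G v) $ i = gross_vec Xs G v $ i"
      using i unfolding U_mat_def net_vec_def gross_vec_def
      by (simp add: scalar_prod_def atLeast0LessThan)
  qed (simp add: U_mat_def gross_vec_def)
  moreover have UL: "(?U * ?L) * (?U * ?L) = 1\<^sub>m ?n"
  proof (rule eq_matI)
    define c where "c j = (-1 :: real) ^ card (edges (fst (Xs ! j)))" for j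
    define g where "g i j = real (gross_count (Xs ! i) (fst (Xs ! j)) (r j))" for i j
    \<comment> \<open>Right multiplication by a diagonal matrix scales column \<open>j\<close> by
      \<open>c j\<close>.\<close>
    have ULm: "?U * ?L = mat ?n ?n (\<lambda>(i, j). g i j * c j)"
      unfolding Lambda_mat_def mat_diag_mult_right[OF U]
      by (rule eq_matI) (auto simp: U_mat_def g_def c_def)
    fix i k assume "i < dim_row (1\<^sub>m ?n :: real mat)" "k < dim_col (1\<^sub>m ?n :: real mat)"
    then have ik: "i < ?n" "k < ?n" by auto
    have "((?U * ?L) * (?U * ?L)) $$ (i, k) = (\<Sum>j<?n. g i j * c j * (g j k * c k))"
      unfolding ULm using ik by (simp add: scalar_prod_def atLeast0LessThan)
    also have "\<dots> = (\<Sum>j<?n. g i j * c j * g j k) * c k"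
      by (simp add: sum_distrib_right mult.assoc)
    also have "(\<Sum>j<?n. g i j * c j * g j k) = (if i = k then c k else 0)"
      unfolding g_def c_def by (rule graphlet_family_alternating[OF assms(2,3) ik])
    \<comment> \<open>On the diagonal the sign meets the factor \<open>c k\<close> of the last
      column scaling, and their product is 1.\<close>
    also have "(if i = k then c k else 0) * c k = 1\<^sub>m ?n $$ (i, k)"
      using ik by (simp add: c_def power_mult_distrib[symmetric])
    finally show "((?U * ?L) * (?U * ?L)) $$ (i, k) = 1\<^sub>m ?n $$ (i, k)" .
  qed (use U L in auto)
  ultimately show ?thesis
    using involutory_inverse[OF U L Lambda_mat_square UL] by blast
qed

end
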